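(* For every prime $p$ and arbitrary fixed $\varepsilon>0$ there exists some $\delta>0$ such that for $p^{\varepsilon}<N<p$ we have $$ I_p(N)\ge p^{\delta}. $$
   Context: Here $N$ denotes a positive integer. For a prime $p$ and an integer $u$ with $\gcd(u,p)=1$, the Fermat quotient $q_p(u)$ is the unique integer with $q_p(u)\equiv \frac{u^{p-1}-1}{p}\pmod p$ and $0\le q_p(u)\le p-1$. The image size of the first $N$ Fermat quotients is $$I_p(N)=\#\{q_p(n)\ :\ 1\le n\le N,\ \gcd(n,p)=1\}.$$
   Formalization: The bound is proved for all primes p ≥ p₀(ε), with δ depending only on ε, rather than for every prime p; as stated it fails, since for p = 1093, N = 2 and small ε one has q_p(1) = q_p(2) = 0, so I_p(2) = 1 < p^δ. *)

theory Defs
  imports Complex_Main "HOL-Number_Theory.Number_Theory"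
begin

(* For p prime and u coprime to p the division is exact, by Fermat's little theorem. *)
definition fermat_quotient :: "nat \<Rightarrow> int \<Rightarrow> int" where
  "fermat_quotient p u =
     (THE q. [q = (u ^ (p - 1) - 1) div int p] (mod int p) \<and> 0 \<le> q \<and> q \<le> int p - 1)"

definition image_size :: "nat \<Rightarrow> nat \<Rightarrow> nat" where
  "image_size p N =
     card {fermat_quotient p (int n) | n. 1 \<le> n \<and> n \<le> N \<and> coprime n p}"

lemma fermat_quotient_eq:
  assumes "p > 0"
  shows "fermat_quotient p u = ((u ^ (p - 1) - 1) div int p) mod int p"
  unfolding fermat_quotient_def
proof (rule the_equality)
  show "[((u ^ (p - 1) - 1) div int p) mod int p = (u ^ (p - 1) - 1) div int p] (mod int p) \<and>
    0 \<le> ((u ^ (p - 1) - 1) div int p) mod int p \<and>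
    ((u ^ (p - 1) - 1) div int p) mod int p \<le> int p - 1"
    using assms pos_mod_bound[of "int p" "(u ^ (p - 1) - 1) div int p"] by (simp add: cong_def)
next
  fix q
  assume "[q = (u ^ (p - 1) - 1) div int p] (mod int p) \<and> 0 \<le> q \<and> q \<le> int p - 1"
  thus "q = ((u ^ (p - 1) - 1) div int p) mod int p"
    by (auto simp: cong_def)
qed

(* Since 1093 is a Wieferich prime, a bound image_size p N \<ge> p powr \<delta> with \<delta> > 0 fails for
   p = 1093, N = 2; such a bound can only be asked for large p when p powr \<epsilon> < 2 is allowed. *)
lemma image_size_1093_2: "image_size 1093 2 = 1"
proof -
  have 1: "fermat_quotient 1093 1 = 0" by (simp add: fermat_quotient_eq)
  have 2: "fermat_quotient 1093 2 = 0"
  proof -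
    have "[(2::int) ^ 28 = 834080] (mod 1093\<^sup>2)" by (simp add: cong_def)
    from cong_pow[OF this, of 3] have "[((2::int) ^ 28) ^ 3 = 834080 ^ 3] (mod 1093\<^sup>2)" .
    also have "[(834080::int) ^ 3 = 230431] (mod 1093\<^sup>2)" by (simp add: cong_def)
    finally have "[(((2::int) ^ 28) ^ 3) ^ 13 = 230431 ^ 13] (mod 1093\<^sup>2)" by (rule cong_pow)
    also have "[(230431::int) ^ 13 = 1] (mod 1093\<^sup>2)" by (simp add: cong_def)
    finally have "1093\<^sup>2 dvd (((2::int) ^ 28) ^ 3) ^ 13 - 1" by (simp only: cong_iff_dvd_diff)
    moreover have "(((2::int) ^ 28) ^ 3) ^ 13 = 2 ^ (28 * 3 * 13)" by (simp only: power_mult)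
    moreover have "28 * 3 * 13 = 1093 - (1::nat)" by simp
    ultimately have "1093\<^sup>2 dvd (2::int) ^ (1093 - 1) - 1" by (simp only:)
    then obtain m where "(2::int) ^ (1093 - 1) - 1 = 1093\<^sup>2 * m" by (elim dvdE)
    hence m: "(2::int) ^ (1093 - 1) - 1 = 1093 * (1093 * m)" by (simp only: power2_eq_square mult.assoc)
    have "((2::int) ^ (1093 - 1) - 1) div 1093 mod 1093 = 0" unfolding m by simp
    thus ?thesis by (simp only: fermat_quotient_eq zero_less_numeral of_nat_numeral)
  qed
  have "{fermat_quotient 1093 (int n) | n. 1 \<le> n \<and> n \<le> 2 \<and> coprime n 1093} = {0}"
  proof (intro equalityI subsetI)
    fix x
    assume "x \<in> {fermat_quotient 1093 (int n) | n. 1 \<le> n \<and> n \<le> 2 \<and> coprime n 1093}"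
    then obtain n :: nat where n: "x = fermat_quotient 1093 (int n)" "1 \<le> n" "n \<le> 2" by auto
    hence "n = 1 \<or> n = 2" by linarith
    thus "x \<in> {0}" using n 1 2 by auto
  next
    fix x :: int
    assume "x \<in> {0}"
    thus "x \<in> {fermat_quotient 1093 (int n) | n. 1 \<le> n \<and> n \<le> 2 \<and> coprime n 1093}"
      using 1 by (auto intro!: exI[of _ "1::nat"])
  qed
  thus ?thesis by (simp add: image_size_def)
qed

end

theory Submission
  imports Defs "HOL-Real_Asymp.Real_Asymp"
begin

text \<open>
  Let \<open>j = \<lceil>2/\<epsilon>\<rceil>\<close>, so that \<open>N ^ j \<ge> p\<^sup>2\<close>. Each value of the Fermat quotient is taken at most once
  per residue class modulo \<open>p\<close> in every interval of length \<open>p\<^sup>2\<close>, hence at most \<open>2 * N ^ j / p\<close> times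
  up to \<open>N ^ j\<close>. On the other hand \<open>q\<^sub>p(u v) = q\<^sub>p(u) + q\<^sub>p(v)\<close> modulo \<open>p\<close>, so on products of \<open>j\<close> distinct
  primes up to \<open>N\<close> it takes at most \<open>I\<^sub>p(N) ^ j\<close> values. By unique factorization and Chebyshev's lower
  bound for \<open>\<pi>(N)\<close> there are at least \<open>(c * N / ln N) ^ j\<close> such products, which forces
  \<open>I\<^sub>p(N) ^ j\<close> to exceed \<open>p\<close> up to a power of \<open>ln p\<close>.
\<close>

subsection \<open>Chebyshev's lower bound\<close>

text \<open>
  The numbers \<open>1 / (m * (n choose m))\<close> form Leibniz's harmonic triangle: the entries for \<open>m = 1\<close> are
  \<open>1 / n\<close>, and each further column consists of differences of the previous one.
\<close>

lemma Lcm_div_leibniz_Ints: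
  fixes N n m :: nat
  assumes "1 \<le> m" "m \<le> n" "n \<le> N"
  shows "real (Lcm {1..N}) / (real m * real (n choose m)) \<in> \<int>"
  using assms
proof (induction m arbitrary: n rule: dec_induct)
  case base
  have "n dvd Lcm {1..N}"
    using base by (intro dvd_Lcm) auto
  then have "real (Lcm {1..N}) / real n \<in> \<int>"
    by (metis Ints_of_nat of_nat_div real_of_nat_div)
  then show ?case by simp
next
  case (step m)
  then obtain n' where n: "n = Suc n'" by (cases n) auto
  have pos: "real (n' choose m) > 0" "real m > 0"
    using step n by auto
  have 1: "real (n choose Suc m) * real (Suc m) = real (Suc n') * real (n' choose m)"
    using Suc_times_binomial_eq[of n' m] unfolding n by (metis of_nat_mult mult.commute)
  have 2: "real (n choose m) * (real (Suc n') - real m) = real (Suc n') * real (n' choose m)"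
  proof -
    have "Suc n' * (n' choose m) = (Suc n' - m) * (Suc n' choose m)"
      using binomial_absorb_comp[of "Suc n'" m] by simp
    then have "real (Suc n') * real (n' choose m) = real (Suc n' - m) * real (Suc n' choose m)"
      by (metis of_nat_mult)
    moreover have "real (Suc n' - m) = real (Suc n') - real m"
      using step n by (intro of_nat_diff) auto
    ultimately show ?thesis by (simp add: n mult.commute)
  qed
  have mn: "real m < real (Suc n')" using step n by auto
  let ?a = "real (n' choose m)" and ?s = "real (Suc n')"
  have e2: "real (n choose m) = ?s * ?a / (?s - real m)"
    using 2 mn by (simp add: field_simps)
  \<comment> \<open>Leibniz's recurrence: an entry of column \<open>Suc m\<close> is the difference
    of the entries of column \<open>m\<close> in rows \<open>n'\<close> and \<open>n\<close>. Both
    rows lie within the range of the induction hypothesis.\<close>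
  have "1 / (real (Suc m) * real (n choose Suc m)) =
        1 / (real m * ?a) - 1 / (real m * real (n choose m))"
  proof -
    have "1 / (real (Suc m) * real (n choose Suc m)) = 1 / (?s * ?a)"
      using 1 by (simp add: mult.commute)
    also have "\<dots> = 1 / (real m * ?a) - 1 / (real m * (?s * ?a / (?s - real m)))"
      using pos mn by (simp add: divide_simps del: of_nat_Suc)
    finally show ?thesis by (simp only: e2)
  qed
  then have "real (Lcm {1..N}) / (real (Suc m) * real (n choose Suc m)) =
        real (Lcm {1..N}) / (real m * ?a) - real (Lcm {1..N}) / (real m * real (n choose m))"
    by (metis (no_types, opaque_lifting) mult.right_neutral right_diff_distrib times_divide_eq_right)
  moreover have "real (Lcm {1..N}) / (real m * ?a) \<in> \<int>"
    using step n by (intro step.IH) auto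
  moreover have "real (Lcm {1..N}) / (real m * real (n choose m)) \<in> \<int>"
    using step n by (intro step.IH) auto
  ultimately show ?case by (metis Ints_diff)
qed

lemma Lcm_atLeastAtMost_pos: "Lcm {1..N} > (0::nat)"
  by (auto simp: Lcm_0_iff intro!: Nat.gr0I)

text \<open>A positive integer is at least 1, so clearing the denominator in row \<open>N\<close> of
  the triangle bounds even \<open>m * (N choose m)\<close>. The columns outside 1 to
  \<open>N\<close> have binomial coefficient at most 1.\<close>

lemma binomial_le_Lcm: "(N choose m) \<le> Lcm {1..N}"
proof (cases "1 \<le> m \<and> m \<le> N")
  case True
  define x where "x = real (Lcm {1..N}) / (real m * real (N choose m))"
  have pos: "real m * real (N choose m) > 0" using True by simp
  have "x \<in> \<int>" unfolding x_def using True by (intro Lcm_div_leibniz_Ints) auto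
  moreover have "x > 0" unfolding x_def using Lcm_atLeastAtMost_pos[of N] pos by simp
  ultimately have "x \<ge> 1" by (auto elim!: Ints_cases)
  then have "real m * real (N choose m) \<le> real (Lcm {1..N})"
    using pos by (simp add: x_def field_simps)
  moreover have "1 * real (N choose m) \<le> real m * real (N choose m)"
    using True by (intro mult_right_mono) auto
  ultimately show ?thesis by linarith
next
  case False
  then have "(N choose m) \<le> 1"
    by (cases "m = 0") (auto simp: binomial_eq_0)
  then show ?thesis using Lcm_atLeastAtMost_pos[of N] by linarith
qed

lemma two_power_le_Lcm: "2 ^ N \<le> Suc N * Lcm {1..N}"
proof -
  have "2 ^ N = (\<Sum>m\<le>N. N choose m)" by (rule choose_row_sum[symmetric])
  also have "\<dots> \<le> (\<Sum>m\<le>N. Lcm {1..N})" by (intro sum_mono binomial_le_Lcm)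
  finally show ?thesis by simp
qed

text \<open>The multiplicity of a prime in an lcm is the maximum of its multiplicities, so it is
  attained by a single element.\<close>

lemma prime_power_dvd_Lcm_imp:
  fixes A :: "nat set"
  assumes "finite A" "prime p" "k > 0" "p ^ k dvd Lcm A"
  shows "\<exists>a\<in>A. p ^ k dvd a"
  using assms(1,4)
proof (induction rule: finite_induct)
  case empty
  then show ?case using assms by (auto simp: prime_gt_Suc_0_nat)
next
  case (insert a A)
  then have d: "p ^ k dvd lcm a (Lcm A)" by simp
  have "p ^ k dvd a \<or> p ^ k dvd Lcm A"
  proof (cases "a = 0 \<or> Lcm A = 0")
    case False
    then have "k \<le> multiplicity p (lcm a (Lcm A))"
      using d assms by (intro multiplicity_geI) (auto simp: lcm_eq_0_iff)
    then have "k \<le> max (multiplicity p a) (multiplicity p (Lcm A))"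
      using False assms by (subst (asm) multiplicity_lcm) auto
    then show ?thesis using multiplicity_dvd' by (auto simp: le_max_iff_disj)
  qed (use d in auto)
  then show ?case using insert by auto
qed

text \<open>Each full prime power in the lcm already divides some number in 1 to \<open>N\<close>,
  so it contributes a factor of at most \<open>N\<close>.\<close>

lemma Lcm_le_power_card_primes:
  assumes "N > 0"
  shows "Lcm {1..N} \<le> N ^ card {q::nat. prime q \<and> q \<le> N}"
proof -
  let ?P = "{q::nat. prime q \<and> q \<le> N}"
  define L where "L = Lcm {1..N}"
  have fin: "finite ?P" by simp
  have L: "L \<noteq> 0" using Lcm_atLeastAtMost_pos[of N] by (simp only: L_def)
  have *: "q ^ multiplicity q L \<le> N \<and> q \<le> N" if q: "q \<in> prime_factors L" for q
  proof -
    have "multiplicity q L > 0" "prime q" using q L by (auto simp: prime_factors_multiplicity)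
    then obtain a where a: "a \<in> {1..N}" "q ^ multiplicity q L dvd a"
      using prime_power_dvd_Lcm_imp[OF finite_atLeastAtMost _ _ multiplicity_dvd] unfolding L_def by blast
    then have "q ^ multiplicity q L \<le> N" by (auto dest!: dvd_imp_le)
    moreover have "q \<le> q ^ multiplicity q L"
      using \<open>prime q\<close> \<open>multiplicity q L > 0\<close> by (intro self_le_power prime_ge_1_nat)
    ultimately show ?thesis by simp
  qed
  have "(\<Prod>q\<in>prime_factors L. q ^ multiplicity q L) \<le> (\<Prod>q\<in>prime_factors L. N)"
  proof (rule prod_mono)
    fix q assume "q \<in> prime_factors L"
    from *[OF this] show "0 \<le> q ^ multiplicity q L \<and> q ^ multiplicity q L \<le> N" by blast
  qed
  also have "\<dots> = N ^ card (prime_factors L)" by simp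
  also have "\<dots> \<le> N ^ card ?P"
  proof -
    have "prime_factors L \<subseteq> ?P" using * by (blast intro: in_prime_factors_imp_prime)
    then show ?thesis using assms by (intro power_increasing card_mono[OF fin]) simp_all
  qed
  finally show ?thesis
    using prime_factorization_nat[of L] L unfolding L_def[symmetric] by simp
qed

text \<open>Logarithms of the two bounds on the lcm are compared. The constant 3 absorbs the factor
  \<open>Suc N\<close>, which is at most \<open>N ^ 2\<close>, into the exponent, as there is at
  least one prime up to \<open>N\<close>.\<close>

lemma card_primes_ge:
  assumes "N \<ge> 2"
  shows "real N * ln 2 \<le> 3 * real (card {q::nat. prime q \<and> q \<le> N}) * ln (real N)"
proof -
  let ?P = "{q::nat. prime q \<and> q \<le> N}"
  have "2 \<in> ?P" using assms by simp
  moreover have "finite ?P" by simp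
  ultimately have "card ?P > 0" unfolding card_gt_0_iff by blast
  then have P: "card ?P \<ge> 1" by linarith
  have "2 * N \<le> N * N" using assms by (intro mult_right_mono) auto
  then have "Suc N \<le> N ^ 2" using assms unfolding power2_eq_square by linarith
  have "2 ^ N \<le> Suc N * Lcm {1..N}" by (rule two_power_le_Lcm)
  also have "\<dots> \<le> N ^ 2 * N ^ card ?P"
    using \<open>Suc N \<le> N ^ 2\<close> assms by (intro mult_mono Lcm_le_power_card_primes) auto
  also have "\<dots> = N ^ (2 + card ?P)" by (simp only: power_add)
  also have "\<dots> \<le> N ^ (3 * card ?P)" using P assms by (intro power_increasing) auto
  finally have "real (2 ^ N) \<le> real (N ^ (3 * card ?P))" by (simp only: of_nat_le_iff)
  then have "ln (2 ^ N :: real) \<le> ln (real N ^ (3 * card ?P))" using assms by (subst ln_le_cancel_iff) auto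
  then show ?thesis using assms by (simp add: ln_realpow)
qed

subsection \<open>Fermat quotients\<close>

lemma fermat_quotient_bounds:
  assumes "p > 0"
  shows "0 \<le> fermat_quotient p u" "fermat_quotient p u < int p"
  using assms by (simp_all add: fermat_quotient_eq)

text \<open>This removes the division: the Fermat quotient becomes the second base-\<open>p\<close>
  digit of \<open>u ^ (p - 1)\<close>, visible modulo the square of \<open>p\<close>.\<close>

lemma fermat_quotient_cong:
  assumes "prime p" "coprime u (int p)"
  shows "[u ^ (p - 1) = 1 + int p * fermat_quotient p u] (mod int p * int p)"
proof -
  have p: "int p > 0" using assms prime_gt_0_nat by simp
  have "prime (int p)" using assms(1) by simp
  have "\<not> int p dvd u"
    using assms(2) \<open>prime (int p)\<close> coprime_common_divisor[of u "int p" "int p"] not_prime_unit by auto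
  define a where "a = nat (u mod int p)"
  have ua: "[u = int a] (mod int p)"
    using p by (simp add: a_def)
  then have "\<not> p dvd a"
    using \<open>\<not> int p dvd u\<close> cong_dvd_iff[OF ua] by simp
  then have "[a ^ (p - 1) = 1] (mod p)"
    using assms(1) by (intro fermat_theorem)
  then have "[int a ^ (p - 1) = 1] (mod int p)"
    by (metis cong_int_iff of_nat_1 of_nat_power)
  then have "[u ^ (p - 1) = 1] (mod int p)"
    using cong_pow[OF ua] by (rule cong_trans[rotated])
  then obtain m where m: "u ^ (p - 1) - 1 = int p * m"
    unfolding cong_iff_dvd_diff by (elim dvdE)
  have "fermat_quotient p u = m mod int p"
    using p m by (simp only: fermat_quotient_eq) simp
  \<comment> \<open>Reducing \<open>m\<close> modulo \<open>p\<close> changes the power only by a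
    multiple of the square of \<open>p\<close>.\<close>
  moreover have "u ^ (p - 1) = 1 + int p * (m mod int p) + int p * int p * (m div int p)"
  proof -
    have "int p * m = int p * (m mod int p + int p * (m div int p))" by simp
    then show ?thesis using m by (simp only: distrib_left mult.assoc)
  qed
  ultimately show ?thesis by (simp add: cong_iff_dvd_diff)
qed

lemma fermat_quotient_unique:
  assumes "prime p" "coprime u (int p)"
    and "[u ^ (p - 1) = 1 + int p * c] (mod int p * int p)"
  shows "fermat_quotient p u = c mod int p"
proof -
  have p: "int p > 0" using assms prime_gt_0_nat by simp
  have "[1 + int p * fermat_quotient p u = 1 + int p * c] (mod int p * int p)"
    using assms fermat_quotient_cong cong_trans cong_sym by blast
  then have "int p * int p dvd int p * (fermat_quotient p u - c)"
    by (simp add: cong_iff_dvd_diff right_diff_distrib)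
  then have "int p dvd fermat_quotient p u - c"
    using p by simp
  then have "fermat_quotient p u mod int p = c mod int p"
    by (simp add: mod_eq_dvd_iff)
  then show ?thesis using fermat_quotient_bounds[of p u] p by simp
qed

text \<open>The Fermat quotient behaves like a logarithm: in the product of \<open>1 + p * a\<close>
  and \<open>1 + p * b\<close>, the cross term vanishes modulo the square of
  \<open>p\<close>.\<close>

lemma fermat_quotient_mult:
  assumes "prime p" "coprime u (int p)" "coprime v (int p)"
  shows "fermat_quotient p (u * v) = (fermat_quotient p u + fermat_quotient p v) mod int p"
proof (rule fermat_quotient_unique)
  let ?a = "fermat_quotient p u" and ?b = "fermat_quotient p v"
  have "[u ^ (p - 1) * v ^ (p - 1) = (1 + int p * ?a) * (1 + int p * ?b)] (mod int p * int p)"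
    using assms by (intro cong_mult fermat_quotient_cong)
  moreover have "(1 + int p * ?a) * (1 + int p * ?b) = 1 + int p * (?a + ?b) + int p * int p * (?a * ?b)"
    by (simp add: algebra_simps)
  then have "[(1 + int p * ?a) * (1 + int p * ?b) = 1 + int p * (?a + ?b)] (mod int p * int p)"
    by (simp add: cong_iff_dvd_diff)
  ultimately show "[(u * v) ^ (p - 1) = 1 + int p * (?a + ?b)] (mod int p * int p)"
    unfolding power_mult_distrib by (rule cong_trans)
qed (use assms in auto)

lemma fermat_quotient_prod_list:
  assumes "prime p" "\<And>x. x \<in> set xs \<Longrightarrow> coprime x (int p)"
  shows "fermat_quotient p (prod_list xs) = sum_list (map (fermat_quotient p) xs) mod int p"
  using assms(2)
proof (induction xs)
  case Nil
  then show ?case using assms(1) prime_gt_0_nat by (simp add: fermat_quotient_eq)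
next
  case (Cons x xs)
  have "coprime (prod_list xs) (int p)"
    using Cons.prems by (intro prod_list_coprime_left) auto
  then show ?case
    using Cons assms(1) by (simp add: fermat_quotient_mult mod_simps)
qed

section \<open>Fibres of the Fermat quotient\<close>

lemma power_self_cong_lift:
  fixes u v :: int
  assumes "[u = v] (mod int p)"
  shows "[u ^ p = v ^ p] (mod int p * int p)"
proof -
  let ?S = "\<Sum>i<p. v ^ (p - Suc i) * u ^ i"
  \<comment> \<open>\<open>?S\<close> is the cofactor of \<open>u - v\<close> in
    \<open>u ^ p - v ^ p\<close>. Its \<open>p\<close> summands agree modulo \<open>p\<close>, which
    yields the second factor \<open>p\<close>.\<close>
  have "[?S = (\<Sum>i<p. v ^ (p - 1))] (mod int p)"
  proof (intro cong_sum)
    fix i assume "i \<in> {..<p}"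
    have "[v ^ (p - Suc i) * u ^ i = v ^ (p - Suc i) * v ^ i] (mod int p)"
      using assms by (intro cong_mult cong_pow cong_refl)
    also have "v ^ (p - Suc i) * v ^ i = v ^ (p - 1)"
      using \<open>i \<in> {..<p}\<close> by (simp flip: power_add)
    finally show "[v ^ (p - Suc i) * u ^ i = v ^ (p - 1)] (mod int p)" .
  qed
  then have "int p dvd ?S"
    by (simp only: cong_dvd_iff) simp
  moreover have "int p dvd u - v"
    using assms by (simp add: cong_iff_dvd_diff)
  ultimately show ?thesis
    by (simp only: cong_iff_dvd_diff power_diff_sumr2 mult_dvd_mono)
qed

text \<open>Modulo the square of \<open>p\<close>, equal quotients equate the powers with exponent
  \<open>p - 1\<close>, and equal residues equate those with exponent \<open>p\<close>. Cancelling
  the unit \<open>u ^ (p - 1)\<close> leaves \<open>u\<close> and \<open>v\<close>.\<close>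

lemma fermat_quotient_inj_mod:
  assumes "prime p" "coprime u (int p)" "coprime v (int p)"
    and "[u = v] (mod int p)" "fermat_quotient p u = fermat_quotient p v"
  shows "[u = v] (mod int p * int p)"
proof -
  have p: "p > 0" using assms prime_gt_0_nat by simp
  have pw: "x ^ p = x ^ (p - 1) * x" for x :: int
    using p by (cases p) (simp_all add: mult.commute)
  have "[u ^ (p - 1) = v ^ (p - 1)] (mod int p * int p)"
    using cong_trans[OF fermat_quotient_cong[OF assms(1,2)], unfolded assms(5),
        OF cong_sym[OF fermat_quotient_cong[OF assms(1,3)]]] .
  then have "[u ^ (p - 1) * v = v ^ (p - 1) * v] (mod int p * int p)"
    by (rule cong_mult[OF _ cong_refl])
  moreover have "[u ^ (p - 1) * u = v ^ (p - 1) * v] (mod int p * int p)"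
    using power_self_cong_lift[OF assms(4)] by (simp only: pw)
  ultimately have "[u ^ (p - 1) * u = u ^ (p - 1) * v] (mod int p * int p)"
    using cong_sym cong_trans by blast
  moreover have "coprime (u ^ (p - 1)) (int p * int p)"
    using assms(2) by simp
  ultimately show ?thesis by (simp add: cong_mult_lcancel)
qed

lemma card_fermat_quotient_fibre_le:
  assumes "prime p" "finite U" "\<And>u. u \<in> U \<Longrightarrow> coprime u p \<and> u \<le> X"
    and "\<And>u. u \<in> U \<Longrightarrow> fermat_quotient p (int u) = a"
  shows "card U \<le> p * Suc (X div (p * p))"
proof -
  \<comment> \<open>An element of the fibre is determined by its residue modulo \<open>p\<close> and
    the block of length \<open>p * p\<close> containing it. The \<open>Suc\<close> in the bound
    counts the last, possibly incomplete, block.\<close>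
  let ?f = "\<lambda>u. (u mod p, u div (p * p))"
  have p: "p > 0" using assms prime_gt_0_nat by simp
  have "inj_on ?f U"
  proof (rule inj_onI)
    fix u v assume uv: "u \<in> U" "v \<in> U" "?f u = ?f v"
    then have "u mod p = v mod p" by simp
    then have "[u = v] (mod p)" by (simp only: unique_euclidean_semiring_class.cong_def)
    then have "[int u = int v] (mod int p)" by (simp only: cong_int_iff)
    then have "[int u = int v] (mod int p * int p)"
      using assms uv by (intro fermat_quotient_inj_mod) auto
    then have "u mod (p * p) = v mod (p * p)"
      unfolding of_nat_mult[symmetric] cong_int_iff
      by (simp only: unique_euclidean_semiring_class.cong_def)
    moreover have "u div (p * p) = v div (p * p)" using uv(3) by simp
    ultimately have "u div (p * p) * (p * p) + u mod (p * p) = v div (p * p) * (p * p) + v mod (p * p)"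
      by simp
    then show "u = v" by (simp only: div_mult_mod_eq)
  qed
  then have "card U \<le> card ({..<p} \<times> {..X div (p * p)})"
    using assms(3) p by (intro card_inj_on_le[where f = ?f]) (auto intro: div_le_mono)
  then show ?thesis by (simp add: card_cartesian_product)
qed

lemma card_fermat_quotient_image_ge:
  assumes "prime p" "finite U" "\<And>u. u \<in> U \<Longrightarrow> coprime u p \<and> u \<le> X"
  shows "card U \<le> card ((\<lambda>u. fermat_quotient p (int u)) ` U) * (p * Suc (X div (p * p)))"
proof -
  let ?q = "\<lambda>u. fermat_quotient p (int u)"
  have "card U = card (\<Union>a\<in>?q ` U. {u \<in> U. ?q u = a})"
    by (rule arg_cong[of _ _ card]) auto
  also have "\<dots> \<le> (\<Sum>a\<in>?q ` U. card {u \<in> U. ?q u = a})"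
    using assms(2) by (intro card_UN_le) auto
  also have "\<dots> \<le> (\<Sum>a\<in>?q ` U. p * Suc (X div (p * p)))"
    using assms by (intro sum_mono card_fermat_quotient_fibre_le) auto
  finally show ?thesis by simp
qed

section \<open>Values of the Fermat quotient on products\<close>

lemma image_size_eq_card_image:
  "image_size p N = card ((\<lambda>n. fermat_quotient p (int n)) ` {n. 1 \<le> n \<and> n \<le> N \<and> coprime n p})"
  unfolding image_size_def by (rule arg_cong[of _ _ card]) auto

lemma card_fermat_quotient_prod_le:
  fixes p N j :: nat
  assumes "prime p"
  defines "V \<equiv> {n. 1 \<le> n \<and> n \<le> N \<and> coprime n p}"
  shows "card ((\<lambda>A. fermat_quotient p (int (\<Prod>A))) ` {A. A \<subseteq> V \<and> card A = j}) \<le> image_size p N ^ j"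
    (is "card ?I \<le> _")
proof -
  let ?Q = "(\<lambda>n. fermat_quotient p (int n)) ` V"
  have finV: "finite V" unfolding V_def by (rule finite_subset[of _ "{..N}"]) auto
  \<comment> \<open>Listing \<open>A\<close> in any order, the quotient of its product depends only
    on the list of \<open>j\<close> single quotients, so counting such lists suffices.\<close>
  have "?I \<subseteq> (\<lambda>ys. sum_list ys mod int p) ` {ys. set ys \<subseteq> ?Q \<and> length ys = j}"
  proof
    fix y assume "y \<in> ?I"
    then obtain A where A: "A \<subseteq> V" "card A = j" "y = fermat_quotient p (int (\<Prod>A))" by blast
    obtain xs where xs: "set xs = A" "distinct xs"
      using finite_distinct_list finite_subset[OF A(1) finV] by blast
    have "int (prod_list zs) = prod_list (map int zs)" for zs
      by (induction zs) auto
    moreover have "\<Prod>A = prod_list xs"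
      using prod.distinct_set_conv_list[OF xs(2), of "\<lambda>x. x"] xs(1) by simp
    ultimately have "int (\<Prod>A) = prod_list (map int xs)" by simp
    then have "y = sum_list (map (fermat_quotient p) (map int xs)) mod int p"
      unfolding A(3) using assms(1) A(1) xs
      by (simp only:, intro fermat_quotient_prod_list) (auto simp: V_def)
    moreover have "set (map (fermat_quotient p) (map int xs)) \<subseteq> ?Q"
      using xs A(1) by auto
    moreover have "length (map (fermat_quotient p) (map int xs)) = j"
      using xs A(2) distinct_card by force
    ultimately show "y \<in> (\<lambda>ys. sum_list ys mod int p) ` {ys. set ys \<subseteq> ?Q \<and> length ys = j}"
      by blast
  qed
  then have "card ?I \<le> card {ys. set ys \<subseteq> ?Q \<and> length ys = j}"
    using finV by (intro surj_card_le finite_lists_length_eq) auto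
  also have "\<dots> = card ?Q ^ j"
    using finV by (intro card_lists_length_eq) auto
  finally show ?thesis by (simp add: image_size_eq_card_image V_def)
qed

lemma prime_factors_prod_primes:
  fixes A :: "nat set"
  assumes "finite A" "\<And>q. q \<in> A \<Longrightarrow> prime q"
  shows "prime_factors (\<Prod>A) = A"
proof -
  have "prime_factors (\<Prod>A) = (\<Union>q\<in>A. prime_factors q)"
    using assms by (subst prime_factors_prod) (auto dest: prime_gt_0_nat)
  also have "\<dots> = (\<Union>q\<in>A. {q})"
    using assms by (intro SUP_cong) (auto simp: prime_prime_factors)
  finally show ?thesis by simp
qed

text \<open>Products of \<open>j\<close> distinct primes are counted in two ways: exactly, by unique
  factorization, and as the number of quotient values times the maximal fibre size.\<close>

lemma choose_card_primes_le:
  fixes p N j :: nat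
  assumes "prime p" "N < p"
  shows "card {q. prime q \<and> q \<le> N} choose j \<le> image_size p N ^ j * (p * Suc (N ^ j div (p * p)))"
proof -
  define P where "P = {q. prime q \<and> q \<le> N}"
  define V where "V = {n. 1 \<le> n \<and> n \<le> N \<and> coprime n p}"
  define S where "S = {A. A \<subseteq> P \<and> card A = j}"
  let ?q = "\<lambda>u. fermat_quotient p (int u)"
  have finP: "finite P" unfolding P_def by simp
  have finV: "finite V" unfolding V_def by (rule finite_subset[of _ "{..N}"]) auto
  have finS: "finite S" unfolding S_def by (rule finite_subset[of _ "Pow P"]) (use finP in auto)
  have sub: "P \<subseteq> V"
    \<comment> \<open>Here \<open>N < p\<close> enters: a prime up to \<open>N\<close> differs from
      \<open>p\<close> and hence is coprime to it.\<close>
    unfolding P_def V_def using assms prime_ge_1_nat by (auto intro!: primes_coprime)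
  have inj: "inj_on Prod S"
  proof (rule inj_on_inverseI[where g = prime_factors])
    fix A assume "A \<in> S"
    then have "A \<subseteq> P" by (simp add: S_def)
    then show "prime_factors (\<Prod>A) = A"
      using finite_subset[OF _ finP] by (intro prime_factors_prod_primes) (auto simp: P_def)
  qed
  have U: "coprime u p \<and> u \<le> N ^ j" if "u \<in> Prod ` S" for u
  proof -
    from that obtain A where "u = \<Prod>A" "A \<in> S" by (rule imageE)
    then have A: "A \<subseteq> P" "card A = j" "u = \<Prod>A" by (simp_all add: S_def)
    have "coprime (\<Prod>A) p"
      using A sub by (intro prod_coprime_left) (auto simp: V_def)
    moreover have "\<Prod>A \<le> (\<Prod>a\<in>A. N)"
      using A by (intro prod_mono) (auto simp: P_def)
    ultimately show ?thesis using A by simp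
  qed
  have "card P choose j = card (Prod ` S)"
    using finP by (simp add: card_image[OF inj]) (simp add: S_def n_subsets)
  also have "\<dots> \<le> card (?q ` (Prod ` S)) * (p * Suc (N ^ j div (p * p)))"
    using assms finS U by (intro card_fermat_quotient_image_ge) auto
  also have "card (?q ` (Prod ` S)) \<le> card ((\<lambda>A. ?q (\<Prod>A)) ` {A. A \<subseteq> V \<and> card A = j})"
  proof (intro card_mono)
    show "finite ((\<lambda>A. ?q (\<Prod>A)) ` {A. A \<subseteq> V \<and> card A = j})"
      by (rule finite_imageI, rule finite_subset[of _ "Pow V"]) (use finV in auto)
    show "?q ` (Prod ` S) \<subseteq> (\<lambda>A. ?q (\<Prod>A)) ` {A. A \<subseteq> V \<and> card A = j}"
      unfolding image_image S_def using sub by (intro image_mono) blast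
  qed
  also have "\<dots> \<le> image_size p N ^ j"
    unfolding V_def using assms by (intro card_fermat_quotient_prod_le)
  finally show ?thesis by (simp add: P_def)
qed

subsection \<open>The size of the image\<close>

lemma image_size_power_ge:
  fixes p N j :: nat
  assumes "prime p" "2 \<le> N" "N < p" "0 < j" "p * p \<le> N ^ j"
    and "j \<le> card {q. prime q \<and> q \<le> N}"
  shows "real p * ln 2 ^ j \<le> 2 * (3 * real j * real (image_size p N) * ln (real N)) ^ j"
proof -
  define c where "c = real (card {q. prime q \<and> q \<le> N})"
  define k where "k = real (image_size p N)"
  have p: "real p > 0" using assms by (simp add: prime_gt_0_nat)
  have c: "c > 0" using assms by (simp add: c_def)
  have "(c / real j) ^ j \<le> real (card {q. prime q \<and> q \<le> N} choose j)"
    unfolding c_def using assms(6) by (rule binomial_ge_n_over_k_pow_k)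
  also have "\<dots> \<le> real (image_size p N ^ j * (p * Suc (N ^ j div (p * p))))"
    using choose_card_primes_le[OF assms(1,3), of j] by (simp only: of_nat_le_iff)
  also have "\<dots> = k ^ j * (real p * (1 + real (N ^ j div (p * p))))"
    by (simp add: k_def distrib_left)
  \<comment> \<open>Since \<open>p * p \<le> N ^ j\<close>, the 1 for the incomplete block costs at
    most a factor 2.\<close>
  also have "\<dots> \<le> k ^ j * (real p * (2 * (real N ^ j / (real p * real p))))"
  proof -
    have "real (N ^ j div (p * p)) \<le> real (N ^ j) / real (p * p)"
      by (rule of_nat_div_le_of_nat)
    moreover have "real (p * p) \<le> real (N ^ j)" using assms(5) by (simp only: of_nat_le_iff)
    then have "1 \<le> real (N ^ j) / real (p * p)" using p by (simp add: field_simps)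
    ultimately have "1 + real (N ^ j div (p * p)) \<le> 2 * (real N ^ j / (real p * real p))" by simp
    then show ?thesis using p by (intro mult_left_mono) (auto simp: k_def)
  qed
  finally have "(c / real j) ^ j \<le> k ^ j * (2 * real N ^ j / real p)"
    using p by simp
  then have "real p * c ^ j \<le> 2 * (k * real j * real N) ^ j"
    using p assms(4) by (simp add: field_simps power_mult_distrib)
  then have "real p * c ^ j * ln 2 ^ j \<le> 2 * (k * real j * real N) ^ j * ln 2 ^ j"
    by (rule mult_right_mono) simp
  also have "\<dots> = 2 * (k * real j) ^ j * (real N * ln 2) ^ j"
    by (simp add: power_mult_distrib)
  \<comment> \<open>Chebyshev's bound trades \<open>N\<close> for the prime count \<open>c\<close>,
    so that \<open>c ^ j\<close> cancels from both sides.\<close>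
  also have "\<dots> \<le> 2 * (k * real j) ^ j * (3 * c * ln (real N)) ^ j"
    using card_primes_ge[OF assms(2)]
    by (intro mult_left_mono power_mono) (auto simp: c_def k_def)
  finally have "(real p * ln 2 ^ j) * c ^ j \<le> (2 * (3 * real j * k * ln (real N)) ^ j) * c ^ j"
    by (simp add: power_mult_distrib ac_simps)
  then show ?thesis using c by (simp add: k_def)
qed

text \<open>Both \<open>\<delta>\<close> and \<open>p\<^sub>0\<close> depend on
  \<open>\<epsilon>\<close> alone. A threshold is unavoidable: by \<open>image_size_1093_2\<close>,
  no positive \<open>\<delta>\<close> serves \<open>p = 1093\<close>, \<open>N = 2\<close> once
  \<open>1093 powr \<epsilon> < 2\<close>.\<close>

theorem theorem12:
  fixes \<epsilon> :: real
  assumes "\<epsilon> > 0"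
  shows "\<exists>\<delta>>0. \<exists>p\<^sub>0::nat. \<forall>p N::nat. prime p \<longrightarrow> p \<ge> p\<^sub>0 \<longrightarrow>
           real p powr \<epsilon> < real N \<longrightarrow> N < p \<longrightarrow>
           real (image_size p N) \<ge> real p powr \<delta>"
proof -
  define j where "j = nat \<lceil>2 / \<epsilon>\<rceil>"
  have "real j \<ge> 2 / \<epsilon>" unfolding j_def by (rule real_nat_ceiling_ge)
  then have j\<epsilon>: "\<epsilon> * real j \<ge> 2" using assms by (simp add: field_simps)
  then have j: "j > 0" by (cases "j = 0") auto
  \<comment> \<open>Up to logarithms the counting gives exponent \<open>1 / j\<close>. Half of it
    leaves a spare factor \<open>x powr \<delta>\<close> to beat them.\<close>
  define \<delta> where "\<delta> = 1 / (2 * real j)"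
  have \<delta>: "\<delta> > 0" using j by (simp add: \<delta>_def)
  \<comment> \<open>This contradicts \<open>image_size_power_ge\<close> as soon as the image size is
    at most \<open>p powr \<delta>\<close>.\<close>
  have "\<forall>\<^sub>F x in at_top. 2 * (3 * real j * x powr \<delta> * ln x) ^ j < x * ln 2 ^ j"
  proof -
    have "\<forall>\<^sub>F x::real in at_top. 6 * real j * ln x < x powr \<delta> * ln 2"
      using \<delta> by real_asymp
    moreover have "\<forall>\<^sub>F x::real in at_top. x > 1" by (rule eventually_gt_at_top)
    ultimately show ?thesis
    proof eventually_elim
      case (elim x)
      have pw: "(x powr \<delta> * x powr \<delta>) ^ j = x"
        using elim j by (simp add: \<delta>_def powr_powr flip: powr_realpow powr_add)
      have "(2::real) ^ 1 \<le> 2 ^ j" using j by (intro power_increasing) auto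
      then have "2 * (3 * real j * x powr \<delta> * ln x) ^ j \<le> 2 ^ j * (3 * real j * x powr \<delta> * ln x) ^ j"
        using elim by (intro mult_right_mono) auto
      also have "\<dots> = (x powr \<delta> * (6 * real j * ln x)) ^ j"
        by (simp add: ac_simps flip: power_mult_distrib)
      also have "\<dots> < (x powr \<delta> * (x powr \<delta> * ln 2)) ^ j"
        using elim j by (intro power_strict_mono mult_strict_left_mono) auto
      also have "\<dots> = x * ln 2 ^ j"
        by (simp only: mult.assoc[symmetric] power_mult_distrib[of _ "ln 2"] pw)
      finally show ?case .
    qed
  qed
  \<comment> \<open>With Chebyshev's bound this will supply at least \<open>j\<close> primes up to
    \<open>N\<close>; the next condition ensures \<open>N \<ge> 2\<close>.\<close>
  moreover have "\<forall>\<^sub>F x::real in at_top. 3 * real j * ln x < x powr \<epsilon> * ln 2"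
    using assms by real_asymp
  moreover have "\<forall>\<^sub>F x::real in at_top. x powr \<epsilon> > 2"
    using assms by real_asymp
  moreover have "\<forall>\<^sub>F x::real in at_top. x > 1" by (rule eventually_gt_at_top)
  ultimately have "\<forall>\<^sub>F x::real in at_top. 2 * (3 * real j * x powr \<delta> * ln x) ^ j < x * ln 2 ^ j \<and>
      3 * real j * ln x < x powr \<epsilon> * ln 2 \<and> x powr \<epsilon> > 2 \<and> x > 1"
    by eventually_elim blast
  then have "\<forall>\<^sub>F p::nat in at_top. 2 * (3 * real j * real p powr \<delta> * ln (real p)) ^ j < real p * ln 2 ^ j \<and>
      3 * real j * ln (real p) < real p powr \<epsilon> * ln 2 \<and> real p powr \<epsilon> > 2 \<and> real p > 1"
    by (rule eventually_compose_filterlim[OF _ filterlim_real_sequentially])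
  then obtain p\<^sub>0 :: nat where p0: "\<And>p. p \<ge> p\<^sub>0 \<Longrightarrow>
      2 * (3 * real j * real p powr \<delta> * ln (real p)) ^ j < real p * ln 2 ^ j \<and>
      3 * real j * ln (real p) < real p powr \<epsilon> * ln 2 \<and> real p powr \<epsilon> > 2 \<and> real p > 1"
    unfolding eventually_at_top_linorder by blast
  have "real p powr \<delta> \<le> real (image_size p N)"
    if p: "prime p" "p \<ge> p\<^sub>0" and N: "real p powr \<epsilon> < real N" "N < p" for p N :: nat
  proof (rule ccontr)
    let ?k = "real (image_size p N)" and ?c = "real (card {q. prime q \<and> q \<le> N})"
    assume "\<not> real p powr \<delta> \<le> ?k"
    then have k: "?k \<le> real p powr \<delta>" by simp
    note large = p0[OF p(2)]
    have N2: "N \<ge> 2" and p1: "real p > 1" using large N by linarith+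
    have lnN: "0 \<le> ln (real N)" "ln (real N) \<le> ln (real p)" and lnp: "ln (real p) > 0"
      using N2 N(2) p1 by auto
    have "3 * real j * ln (real p) < real N * ln 2"
      by (rule less_trans[OF conjunct1[OF conjunct2[OF large]] mult_strict_right_mono[OF N(1)]]) simp
    also have "\<dots> \<le> 3 * ?c * ln (real N)" by (rule card_primes_ge[OF N2])
    also have "\<dots> \<le> 3 * ?c * ln (real p)" using lnN by (intro mult_left_mono) auto
    finally have jc: "j \<le> card {q. prime q \<and> q \<le> N}" using lnp by simp
    \<comment> \<open>The choice of \<open>j\<close> pays off: \<open>\<epsilon> * j \<ge> 2\<close>
      makes \<open>N ^ j\<close> reach the square of \<open>p\<close>.\<close>
    have "real p * real p = real p powr 2" using p1 by (simp add: power2_eq_square)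
    also have "\<dots> \<le> real p powr (\<epsilon> * real j)" using p1 j\<epsilon> by (intro powr_mono) auto
    also have "\<dots> = (real p powr \<epsilon>) ^ j" using p1 by (simp add: powr_powr flip: powr_realpow)
    also have "\<dots> \<le> real N ^ j" using N(1) by (intro power_mono) auto
    finally have "p * p \<le> N ^ j" by (simp flip: of_nat_mult of_nat_power)
    then have "real p * ln 2 ^ j \<le> 2 * (3 * real j * ?k * ln (real N)) ^ j"
      using p N N2 j jc by (intro image_size_power_ge) auto
    also have "\<dots> \<le> 2 * (3 * real j * real p powr \<delta> * ln (real p)) ^ j"
      using k lnN by (intro mult_left_mono power_mono mult_mono) auto
    finally show False using large by simp
  qed
  with \<delta> show ?thesis by blast
qed

end
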